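(* Let $R\in\{\mathbf{L},\mathbf{H}\}$ and let $S \subsetneq R$ be nonempty. Assume that $S \subseteq \mathcal{C}_R(m)$ for some monic quadratic $m \in \mathbb{Z}[x]$. Then there exists a reduced set $T \subsetneq R$ such that $S = a+nT$ for some $a, n \in \mathbb{Z}$ with $n \geq 1$. Moreover, $S$ is a ringset if and only if $T$ is a ringset.
   Context: Let $\mathbb{D}=\{a_0+a_1\mathbf{i}+a_2\mathbf{j}+a_3\mathbf{k} \mid a_0,\dots,a_3\in\mathbb{Q}\}$ be the division ring of rational quaternions, with $\mathbf{i}^2=\mathbf{j}^2=-1$ and $\mathbf{i}\mathbf{j}=\mathbf{k}=-\mathbf{j}\mathbf{i}$. Let $\mathbf{L}$ (Lipschitz quaternions) be the subring of elements with all $a_i\in\mathbb{Z}$, and $\mathbf{H}$ (Hurwitz quaternions) the subring of elements with either all $a_i\in\mathbb{Z}$ or all $a_i\in\mathbb{Z}+\frac12$. In $\mathbb{D}[x]$ the indeterminate $x$ is central, and polynomials are evaluated with coefficients on the left: for $f=\sum_i a_i x^i$ and $\alpha\in\mathbb{D}$, $f(\alpha)=\sum_i a_i\alpha^i$. For $S\subseteq R$, $\mathrm{Int}(S,R)=\{f\in\mathbb{D}[x]\mid f(S)\subseteq R\}$, and $S$ is a ringset (of $R$) if $\mathrm{Int}(S,R)$ is a subring of $\mathbb{D}[x]$. For $\alpha=a_0+a_1\mathbf{i}+a_2\mathbf{j}+a_3\mathbf{k}$, the norm is $N(\alpha)=a_0^2+a_1^2+a_2^2+a_3^2$. The minimal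 polynomial $\mu_\alpha$ of $\alpha$ is $x-\alpha$ if $\alpha\in\mathbb{Q}$, and $x^2-2a_0x+N(\alpha)$ if $\alpha\in\mathbb{D}\setminus\mathbb{Q}$. For $m\in\mathbb{Z}[x]$ monic of degree 1 or 2, $\mathcal{C}_R(m)=\{\alpha\in R\mid\mu_\alpha=m\}$. For $T\subseteq R$ and $a,n\in\mathbb{Z}$, $T+a=a+T=\{\alpha+a\mid\alpha\in T\}$ and $nT=\{n\alpha\mid\alpha\in T\}$. A subset $T\subseteq R$ is reduced (with respect to $R$) if (i) $T\subseteq\mathcal{C}_R(m)$ for some monic quadratic $m\in\mathbb{Z}[x]$, and (ii) for all $a\in\mathbb{Z}$ and all integers $n\geq2$, $T+a\not\subseteq nR$. *)

theory Defs
  imports "HOL-Algebra.UnivPoly" "HOL-Algebra.Subrings" "HOL-Algebra.Algebraic_Closure_Type"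
begin

section \<open>Rational quaternions\<close>

codatatype quat = Quat (q_re: rat) (q_i: rat) (q_j: rat) (q_k: rat)

lemma quat_eq_iff:
  "x = y \<longleftrightarrow> q_re x = q_re y \<and> q_i x = q_i y \<and> q_j x = q_j y \<and> q_k x = q_k y"
  by (auto intro: quat.expand)

definition qnorm :: "quat \<Rightarrow> rat"
  where "qnorm \<alpha> = (q_re \<alpha>)\<^sup>2 + (q_i \<alpha>)\<^sup>2 + (q_j \<alpha>)\<^sup>2 + (q_k \<alpha>)\<^sup>2"

lemma qnorm_eq_0_iff:
  "qnorm \<alpha> = 0 \<longleftrightarrow> q_re \<alpha> = 0 \<and> q_i \<alpha> = 0 \<and> q_j \<alpha> = 0 \<and> q_k \<alpha> = 0"
  unfolding qnorm_def by (simp add: add_nonneg_eq_0_iff conj_assoc)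

instantiation quat :: ab_group_add
begin

primcorec zero_quat where
  "q_re 0 = 0" | "q_i 0 = 0" | "q_j 0 = 0" | "q_k 0 = 0"

primcorec plus_quat where
  "q_re (x + y) = q_re x + q_re y"
| "q_i (x + y) = q_i x + q_i y"
| "q_j (x + y) = q_j x + q_j y"
| "q_k (x + y) = q_k x + q_k y"

primcorec uminus_quat where
  "q_re (- x) = - q_re x"
| "q_i (- x) = - q_i x"
| "q_j (- x) = - q_j x"
| "q_k (- x) = - q_k x"

primcorec minus_quat where
  "q_re (x - y) = q_re x - q_re y"
| "q_i (x - y) = q_i x - q_i y"
| "q_j (x - y) = q_j x - q_j y"
| "q_k (x - y) = q_k x - q_k y"

instance
  by standard (simp_all add: quat_eq_iff)

end

instantiation quat :: ring_1
begin

primcorec one_quat where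
  "q_re 1 = 1" | "q_i 1 = 0" | "q_j 1 = 0" | "q_k 1 = 0"

primcorec times_quat where
  "q_re (x * y) = q_re x * q_re y - q_i x * q_i y - q_j x * q_j y - q_k x * q_k y"
| "q_i (x * y) = q_re x * q_i y + q_i x * q_re y + q_j x * q_k y - q_k x * q_j y"
| "q_j (x * y) = q_re x * q_j y - q_i x * q_k y + q_j x * q_re y + q_k x * q_i y"
| "q_k (x * y) = q_re x * q_k y + q_i x * q_j y - q_j x * q_i y + q_k x * q_re y"

instance
  by standard (simp_all add: quat_eq_iff algebra_simps)

end

instantiation quat :: division_ring
begin

primcorec inverse_quat where
  "q_re (inverse x) = q_re x / qnorm x"
| "q_i (inverse x) = - q_i x / qnorm x"
| "q_j (inverse x) = - q_j x / qnorm x"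
| "q_k (inverse x) = - q_k x / qnorm x"

definition "x div y = x * inverse y" for x y :: quat

instance
proof
  fix a b :: quat
  show "a div b = a * inverse b" by (simp add: divide_quat_def)
  show "inverse 0 = (0 :: quat)" by (simp add: quat_eq_iff)
  assume "a \<noteq> 0"
  then have "qnorm a \<noteq> 0" by (simp add: qnorm_eq_0_iff quat_eq_iff)
  then show "inverse a * a = 1" "a * inverse a = 1"
    by (simp_all add: quat_eq_iff divide_simps)
      (simp_all add: qnorm_def power2_eq_square algebra_simps)
qed

end

lemma quat_units:
  "Quat 0 1 0 0 * Quat 0 1 0 0 = - 1"
  "Quat 0 0 1 0 * Quat 0 0 1 0 = - 1"
  "Quat 0 1 0 0 * Quat 0 0 1 0 = Quat 0 0 0 1"
  "Quat 0 0 1 0 * Quat 0 1 0 0 = - Quat 0 0 0 1"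
  by (simp_all add: quat_eq_iff)

lemma quat_of_nat [simp]:
  "q_re (of_nat n) = of_nat n" "q_i (of_nat n) = 0" "q_j (of_nat n) = 0" "q_k (of_nat n) = 0"
  by (induction n) simp_all

lemma quat_of_int: "of_int a = Quat (of_int a) 0 0 0"
  by (cases a rule: int_diff_cases) (simp add: quat_eq_iff)

definition Lipschitz :: "quat set"
  where "Lipschitz = {\<alpha>. q_re \<alpha> \<in> \<int> \<and> q_i \<alpha> \<in> \<int> \<and> q_j \<alpha> \<in> \<int> \<and> q_k \<alpha> \<in> \<int>}"

definition half_ints :: "rat set"
  where "half_ints = {of_int k + 1 / 2 | k :: int. True}"

definition Hurwitz :: "quat set"
  where "Hurwitz = {\<alpha>. (q_re \<alpha> \<in> \<int> \<and> q_i \<alpha> \<in> \<int> \<and> q_j \<alpha> \<in> \<int> \<and> q_k \<alpha> \<in> \<int>) \<or>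
    (q_re \<alpha> \<in> half_ints \<and> q_i \<alpha> \<in> half_ints \<and> q_j \<alpha> \<in> half_ints \<and> q_k \<alpha> \<in> half_ints)}"


section \<open>Integer-valued polynomials over the quaternions\<close>

text \<open>
  The type \<open>'a poly\<close> has a multiplication only for commutative coefficients, so
  polynomials over the quaternions are taken from \<^const>\<open>UP\<close>, which is a ring over any
  coefficient ring and in which the indeterminate is central.
\<close>

abbreviation QD :: "quat ring"
  where "QD \<equiv> ring_of_type_algebra"

lemma QD_simps:
  "carrier QD = UNIV" "\<one>\<^bsub>QD\<^esub> = 1" "\<zero>\<^bsub>QD\<^esub> = 0" "x \<oplus>\<^bsub>QD\<^esub> y = x + y" "x \<otimes>\<^bsub>QD\<^esub> y = x * y"
  by (simp_all add: ring_of_type_algebra_def)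

lemma ring_QD: "ring QD"
proof -
  have "\<exists>y. x + y = 0" for x :: quat
    using add.right_inverse by blast
  then show ?thesis
    unfolding ring_of_type_algebra_def using add.right_inverse
    by unfold_locales (auto simp: algebra_simps Units_def)
qed

abbreviation QDx :: "(quat, nat \<Rightarrow> quat) up_ring"
  where "QDx \<equiv> UP QD"

lemma ring_QDx: "ring QDx"
proof -
  interpret UP_ring QD QDx
    by (simp add: UP_ring_def ring_QD)
  show ?thesis by (rule UP_ring)
qed

text \<open>
  \<^const>\<open>eval\<close> puts the coefficients to the left of the powers of the argument. For
  noncommutative coefficients it is not multiplicative in the polynomial.
\<close>

abbreviation qeval :: "(nat \<Rightarrow> quat) \<Rightarrow> quat \<Rightarrow> quat"
  where "qeval f \<alpha> \<equiv> eval QD QD id \<alpha> f"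

lemma qeval_eq:
  assumes "f \<in> carrier QDx"
  shows "qeval f \<alpha> = (\<Sum>i\<le>deg QD f. up_ring.coeff QDx f i * \<alpha> ^ i)"
proof -
  interpret ring QD by (rule ring_QD)
  have fin: "finsum QD g A = sum g A" if "finite A" for g :: "nat \<Rightarrow> quat" and A
    using that by (induction A) (simp_all add: finsum_insert QD_simps)
  have "\<alpha> [^]\<^bsub>QD\<^esub> i = \<alpha> ^ i" for i :: nat
    by (induction i) (simp_all add: QD_simps power_Suc2 del: power_Suc)
  then show ?thesis
    using assms by (simp add: eval_def fin QD_simps)
qed

definition IntVal :: "quat set \<Rightarrow> quat set \<Rightarrow> (nat \<Rightarrow> quat) set"
  where "IntVal S R = {f \<in> carrier QDx. \<forall>\<alpha>\<in>S. qeval f \<alpha> \<in> R}"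

definition ringset :: "quat set \<Rightarrow> quat set \<Rightarrow> bool"
  where "ringset R S \<longleftrightarrow> S \<subseteq> R \<and> subring (IntVal S R) QDx"


section \<open>Minimal polynomials and reduced sets\<close>

text \<open>Minimal polynomials have central coefficients, so here the commutative type suffices.\<close>

definition min_poly :: "quat \<Rightarrow> rat poly"
  where "min_poly \<alpha> =
    (if q_i \<alpha> = 0 \<and> q_j \<alpha> = 0 \<and> q_k \<alpha> = 0 then [:- q_re \<alpha>, 1:]
     else [:qnorm \<alpha>, - 2 * q_re \<alpha>, 1:])"

definition min_poly_class :: "quat set \<Rightarrow> int poly \<Rightarrow> quat set"
  where "min_poly_class R m = {\<alpha> \<in> R. min_poly \<alpha> = map_poly of_int m}"

definition monic_quadratic :: "int poly \<Rightarrow> bool"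
  where "monic_quadratic m \<longleftrightarrow> Polynomial.degree m = 2 \<and> Polynomial.lead_coeff m = 1"

definition translate :: "int \<Rightarrow> quat set \<Rightarrow> quat set"
  where "translate a T = {of_int a + \<alpha> | \<alpha>. \<alpha> \<in> T}"

definition dilate :: "int \<Rightarrow> quat set \<Rightarrow> quat set"
  where "dilate n T = {of_int n * \<alpha> | \<alpha>. \<alpha> \<in> T}"

definition reduced :: "quat set \<Rightarrow> quat set \<Rightarrow> bool"
  where "reduced R T \<longleftrightarrow>
    T \<subseteq> R \<and>
    (\<exists>m. monic_quadratic m \<and> T \<subseteq> min_poly_class R m) \<and>
    (\<forall>a n. n \<ge> 2 \<longrightarrow> \<not> translate a T \<subseteq> dilate n R)"

end

theory Submission
  imports Defs
begin

text \<open>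
  The two halves of the proof are independent.

  For the existence of \<open>T\<close>, choose \<open>S \<subseteq> a + n R\<close> with \<open>n\<close> as large as possible and let
  \<open>T = (S - a) / n\<close>. A largest \<open>n\<close> exists because \<open>S\<close> contains a quaternion outside \<open>\<rat>\<close>,
  and its imaginary components, which lie in \<open>(n / 2) \<int>\<close>, are not all zero
  (\<open>dilation_factor_bounded\<close>). Maximality of \<open>n\<close> says that no translate of \<open>T\<close> lies in
  \<open>k R\<close> for \<open>k \<ge> 2\<close>. All elements of \<open>S\<close> have the same trace and the same norm, hence so
  have the elements of \<open>T\<close>; these are integers because \<open>T \<subseteq> R\<close>, so \<open>T\<close> lies in one
  minimal polynomial class (\<open>ex_reduced_affine_preimage\<close>). The inclusion \<open>T \<subset> R\<close> is
  proper since \<open>0 \<in> R\<close> is scalar.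

  The second half is a change of variable. The substitution \<open>x \<mapsto> n x + a\<close> is an automorphism of the polynomial ring, as \<open>a\<close> and \<open>n\<close>
  are central and \<open>n\<close> is invertible, and it maps the polynomials that are integer-valued on
  \<open>S\<close> onto those that are integer-valued on \<open>T\<close>. The automorphism itself is never constructed.
  Evaluation is not multiplicative, but
  \<open>(f g)(\<alpha>) = f(b \<alpha> b\<inverse>) b\<close> if \<open>b = g(\<alpha>)\<close> is nonzero, and
  \<open>(f g)(\<alpha>) = 0\<close> otherwise (\<open>qeval_mult\<close>). Thus the values of a product depend on the
  factors only as functions, and it suffices that composing a polynomial function with a central
  affine map gives a polynomial function (\<open>affine_substitution\<close>); central affine maps commute
  with the conjugation in the formula (\<open>ringset_affine_image\<close>).
\<close>

section \<open>Evaluation of sums and products\<close>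

interpretation QDx: UP_ring QD QDx
  by (simp_all add: UP_ring_def ring_QD)

lemma finsum_QD: "finsum QD g A = sum g A" if "finite A"
  using that by (induction A) (simp_all add: QD_simps)

lemma coeff_above_deg: "up_ring.coeff QDx f i = 0" if "f \<in> carrier QDx" "deg QD f < i"
  using QDx.deg_aboveD[OF that(2,1)] by (simp add: QD_simps)

lemma qeval_eq_bound:
  assumes "f \<in> carrier QDx" "deg QD f \<le> N"
  shows "qeval f \<alpha> = (\<Sum>i\<le>N. up_ring.coeff QDx f i * \<alpha> ^ i)"
  unfolding qeval_eq[OF assms(1)]
  by (rule sum.mono_neutral_left) (use assms in \<open>auto simp: coeff_above_deg\<close>)

lemma qeval_add:
  assumes f: "f \<in> carrier QDx" and g: "g \<in> carrier QDx"
  shows "qeval (f \<oplus>\<^bsub>QDx\<^esub> g) \<alpha> = qeval f \<alpha> + qeval g \<alpha>"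
proof -
  define N where "N = max (deg QD f) (deg QD g)"
  have "deg QD (f \<oplus>\<^bsub>QDx\<^esub> g) \<le> N"
    unfolding N_def using f g by (rule QDx.deg_add)
  then have "qeval (f \<oplus>\<^bsub>QDx\<^esub> g) \<alpha> =
      (\<Sum>i\<le>N. up_ring.coeff QDx (f \<oplus>\<^bsub>QDx\<^esub> g) i * \<alpha> ^ i)"
    using f g by (intro qeval_eq_bound) auto
  also have "\<dots> = (\<Sum>i\<le>N. up_ring.coeff QDx f i * \<alpha> ^ i) + (\<Sum>i\<le>N. up_ring.coeff QDx g i * \<alpha> ^ i)"
    using f g by (simp add: QDx.coeff_add QD_simps distrib_right sum.distrib)
  also have "\<dots> = qeval f \<alpha> + qeval g \<alpha>"
    using f g by (simp add: qeval_eq_bound[where N = N] N_def)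
  finally show ?thesis .
qed

lemma qeval_monom: "qeval (up_ring.monom QDx c n) \<alpha> = c * \<alpha> ^ n"
proof -
  have "qeval (up_ring.monom QDx c n) \<alpha> =
      (\<Sum>i\<le>n. up_ring.coeff QDx (up_ring.monom QDx c n) i * \<alpha> ^ i)"
    by (intro qeval_eq_bound QDx.monom_closed QDx.deg_monom_le) (simp_all add: QD_simps)
  also have "\<dots> = (\<Sum>i\<le>n. if n = i then c * \<alpha> ^ n else 0)"
    by (intro sum.cong) (simp_all add: QDx.coeff_monom QD_simps)
  finally show ?thesis by simp
qed

lemma qeval_one: "qeval \<one>\<^bsub>QDx\<^esub> \<alpha> = 1"
  using qeval_monom[where c = 1 and n = 0] QDx.monom_one by (simp add: QD_simps)

lemma qeval_minus:
  assumes "f \<in> carrier QDx"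
  shows "qeval (\<ominus>\<^bsub>QDx\<^esub> f) \<alpha> = - qeval f \<alpha>"
proof -
  have "qeval (\<ominus>\<^bsub>QDx\<^esub> f \<oplus>\<^bsub>QDx\<^esub> f) \<alpha> = 0"
    using assms qeval_monom[where c = 0 and n = 0] QDx.monom_zero
    by (simp add: QDx.P.l_neg QD_simps)
  then show ?thesis
    using assms by (simp add: qeval_add eq_neg_iff_add_eq_0)
qed

text \<open>
  The coefficient of \<open>x ^ n\<close> in the product is a sum of \<open>f i * g j\<close> with \<open>i + j = n\<close>. Since
  \<open>x\<close> is central as an indeterminate but \<^term>\<open>\<alpha>\<close> is not, summing over \<open>j\<close> first puts the
  value of the right factor between the coefficients and the powers of the left factor.
\<close>

lemma qeval_mult_sum:
  assumes f: "f \<in> carrier QDx" and g: "g \<in> carrier QDx"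
  shows "qeval (f \<otimes>\<^bsub>QDx\<^esub> g) \<alpha> =
    (\<Sum>i\<le>deg QD f. up_ring.coeff QDx f i * qeval g \<alpha> * \<alpha> ^ i)"
proof -
  let ?a = "up_ring.coeff QDx f" and ?b = "up_ring.coeff QDx g"
  define M N where "M = deg QD f" and "N = deg QD g"
  define t where "t = (\<lambda>i j. ?a i * ?b j * \<alpha> ^ (i + j))"
  have a0: "?a i = 0" if "i > M" for i using f that by (simp add: M_def coeff_above_deg)
  have b0: "?b j = 0" if "j > N" for j using g that by (simp add: N_def coeff_above_deg)
  have deg: "deg QD (f \<otimes>\<^bsub>QDx\<^esub> g) \<le> M + N"
    unfolding M_def N_def using f g by (rule QDx.deg_mult_ring)
  have "qeval (f \<otimes>\<^bsub>QDx\<^esub> g) \<alpha> =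
      (\<Sum>n\<le>M + N. up_ring.coeff QDx (f \<otimes>\<^bsub>QDx\<^esub> g) n * \<alpha> ^ n)"
    using f g deg by (intro qeval_eq_bound) auto
  also have "\<dots> = (\<Sum>n\<le>M + N. \<Sum>i\<le>n. t i (n - i))"
    using f g by (intro sum.cong)
      (simp_all add: QDx.coeff_mult finsum_QD QD_simps sum_distrib_right t_def)
  also have "\<dots> = (\<Sum>(i, j)\<in>{(i, j). i + j \<le> M + N}. t i j)"
    by (rule sum.triangle_reindex_eq[symmetric])
  also have "\<dots> = (\<Sum>(i, j)\<in>{..M} \<times> {..N}. t i j)"
  proof (rule sum.mono_neutral_right)
    show "finite {(i, j). i + j \<le> M + N}"
      by (rule finite_subset[of _ "{..M + N} \<times> {..M + N}"]) auto
    show "\<forall>p\<in>{(i, j). i + j \<le> M + N} - {..M} \<times> {..N}. (case p of (i, j) \<Rightarrow> t i j) = 0"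
      by (force simp: t_def intro: leI a0 b0)
  qed auto
  also have "\<dots> = (\<Sum>i\<le>M. \<Sum>j\<le>N. t i j)"
    by (rule sum.cartesian_product[symmetric])
  also have "\<dots> = (\<Sum>i\<le>M. ?a i * qeval g \<alpha> * \<alpha> ^ i)"
    unfolding t_def qeval_eq[OF g] N_def
    by (intro sum.cong)
      (simp_all add: sum_distrib_left sum_distrib_right mult.assoc power_add[symmetric] add.commute)
  finally show ?thesis by (simp add: M_def)
qed

text \<open>
  Moving a nonzero value \<open>b\<close> of the right factor past the powers of \<^term>\<open>\<alpha>\<close> conjugates
  \<^term>\<open>\<alpha>\<close> by \<open>b\<close>. The value of a product is thereby determined by the two factors as
  functions on all quaternions, without reference to their coefficients.
\<close>

lemma qeval_mult:
  assumes f: "f \<in> carrier QDx" and g: "g \<in> carrier QDx"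
  shows "qeval (f \<otimes>\<^bsub>QDx\<^esub> g) \<alpha> =
    (if qeval g \<alpha> = 0 then 0
     else qeval f (qeval g \<alpha> * \<alpha> * inverse (qeval g \<alpha>)) * qeval g \<alpha>)"
proof (cases "qeval g \<alpha> = 0")
  case True
  then show ?thesis by (simp add: qeval_mult_sum[OF f g])
next
  case False
  define b where "b = qeval g \<alpha>"
  have b: "b \<noteq> 0" using False by (simp add: b_def)
  have conj: "(b * \<alpha> * inverse b) ^ i * b = b * \<alpha> ^ i" for i
  proof (induction i)
    case (Suc i)
    have "(b * \<alpha> * inverse b) ^ Suc i * b = b * \<alpha> * inverse b * (b * \<alpha> ^ i)"
      by (simp only: power_Suc mult.assoc Suc.IH[unfolded mult.assoc])
    also have "\<dots> = b * \<alpha> * (inverse b * b) * \<alpha> ^ i" by (simp only: mult.assoc)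
    finally show ?case using b by (simp add: mult.assoc)
  qed simp
  have "qeval (f \<otimes>\<^bsub>QDx\<^esub> g) \<alpha> = qeval f (b * \<alpha> * inverse b) * b"
    unfolding qeval_mult_sum[OF f g] qeval_eq[OF f] b_def[symmetric]
    unfolding sum_distrib_right by (intro sum.cong refl) (metis conj mult.assoc)
  then show ?thesis using b by (simp add: b_def)
qed


section \<open>Affine substitution and ringsets\<close>

text \<open>
  The functions given by polynomials are closed under sums, left multiplication by constants, and
  right multiplication by the argument, which together generate \<open>r (c q + d) ^ i\<close>.
  Centrality of \<^term>\<open>c\<close> and \<^term>\<open>d\<close> is what allows the coefficients of the
  substituted polynomial to be collected on the left.
\<close>

lemma affine_substitution:
  assumes f: "f \<in> carrier QDx"
    and c: "\<And>q. c * q = q * c" and d: "\<And>q. d * q = q * d"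
  obtains g where "g \<in> carrier QDx" "\<And>q. qeval g q = qeval f (c * q + d)"
proof -
  define poly_fun where
    "poly_fun = (\<lambda>h. \<exists>g\<in>carrier QDx. \<forall>q. qeval g q = (h q :: quat))"
  have sum: "poly_fun (\<lambda>q. h q + k q)" if "poly_fun h" "poly_fun k" for h k
    using that unfolding poly_fun_def
    by (metis QDx.P.add.m_closed qeval_add)
  have const: "poly_fun (\<lambda>q. r)" for r
    unfolding poly_fun_def
    by (intro bexI[of _ "up_ring.monom QDx r 0"])
      (auto simp: qeval_monom QD_simps)
  have scale: "poly_fun (\<lambda>q. r * h q)" if h: "poly_fun h" for r h
  proof -
    from h obtain g where g: "g \<in> carrier QDx" "\<And>q. qeval g q = h q"
      unfolding poly_fun_def by blast
    have "qeval (up_ring.monom QDx r 0 \<otimes>\<^bsub>QDx\<^esub> g) q = r * h q" for q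
      using g by (subst qeval_mult) (auto simp: qeval_monom QD_simps)
    then show ?thesis
      unfolding poly_fun_def using g(1)
      by (intro bexI[of _ "up_ring.monom QDx r 0 \<otimes>\<^bsub>QDx\<^esub> g"]) (auto simp: QD_simps)
  qed
  have shift: "poly_fun (\<lambda>q. h q * q)" if h: "poly_fun h" for h
  proof -
    from h obtain g where g: "g \<in> carrier QDx" "\<And>q. qeval g q = h q"
      unfolding poly_fun_def by blast
    have "q * q * inverse q = q" for q :: quat
      by (cases "q = 0") (simp_all add: mult.assoc)
    then have "qeval (g \<otimes>\<^bsub>QDx\<^esub> up_ring.monom QDx 1 1) q = h q * q" for q
      using g by (subst qeval_mult) (auto simp: qeval_monom QD_simps)
    then show ?thesis
      unfolding poly_fun_def using g(1)
      by (intro bexI[of _ "g \<otimes>\<^bsub>QDx\<^esub> up_ring.monom QDx 1 1"]) (auto simp: QD_simps)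
  qed
  have power: "poly_fun (\<lambda>q. r * (c * q + d) ^ i)" for r i
  proof (induction i)
    case 0
    then show ?case using const[of r] by simp
  next
    case (Suc i)
    have "r * (c * q + d) ^ Suc i =
        c * ((r * (c * q + d) ^ i) * q) + d * (r * (c * q + d) ^ i)" for q
    proof -
      define x where "x = r * (c * q + d) ^ i"
      have "r * (c * q + d) ^ Suc i = x * (c * q + d)"
        by (simp add: x_def power_Suc2 mult.assoc del: power_Suc)
      also have "\<dots> = c * (x * q) + d * x"
        by (metis c d distrib_left mult.assoc)
      finally show ?thesis by (simp add: x_def)
    qed
    then show ?case
      using sum[OF scale[OF shift[OF Suc.IH], of c] scale[OF Suc.IH, of d]] by simp
  qed
  have "poly_fun (\<lambda>q. \<Sum>i\<le>n. up_ring.coeff QDx f i * (c * q + d) ^ i)" for n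
  proof (induction n)
    case 0
    show ?case using power[of _ 0] by simp
  next
    case (Suc n)
    from sum[OF this power] show ?case by (simp only: sum.atMost_Suc)
  qed
  then have "poly_fun (\<lambda>q. qeval f (c * q + d))"
    by (simp add: qeval_eq[OF f])
  then show ?thesis
    using that unfolding poly_fun_def by blast
qed

text \<open>
  Under this condition the integer-valued polynomials always form an additive group with one, so
  that being a ringset amounts to closure under multiplication.
\<close>

definition unital_subgroup :: "quat set \<Rightarrow> bool"
  where "unital_subgroup R \<longleftrightarrow>
    1 \<in> R \<and> (\<forall>x\<in>R. - x \<in> R) \<and> (\<forall>x\<in>R. \<forall>y\<in>R. x + y \<in> R)"

lemma ringset_iff_mult_closed:
  assumes "unital_subgroup R"
  shows "ringset R S \<longleftrightarrow>
    S \<subseteq> R \<and> (\<forall>f\<in>IntVal S R. \<forall>g\<in>IntVal S R. f \<otimes>\<^bsub>QDx\<^esub> g \<in> IntVal S R)"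
proof -
  have "subring (IntVal S R) QDx"
    if "\<forall>f\<in>IntVal S R. \<forall>g\<in>IntVal S R. f \<otimes>\<^bsub>QDx\<^esub> g \<in> IntVal S R"
  proof (rule ring.subringI[OF ring_QDx])
    show "IntVal S R \<subseteq> carrier QDx" by (auto simp: IntVal_def)
    show "\<one>\<^bsub>QDx\<^esub> \<in> IntVal S R"
      using assms by (auto simp: IntVal_def qeval_one unital_subgroup_def)
    show "\<ominus>\<^bsub>QDx\<^esub> h \<in> IntVal S R" if "h \<in> IntVal S R" for h
      using assms that by (auto simp: IntVal_def qeval_minus unital_subgroup_def)
    show "h \<oplus>\<^bsub>QDx\<^esub> k \<in> IntVal S R" if "h \<in> IntVal S R" "k \<in> IntVal S R" for h k
      using assms that by (auto simp: IntVal_def qeval_add unital_subgroup_def)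
  qed (use that in auto)
  moreover have "f \<otimes>\<^bsub>QDx\<^esub> g \<in> IntVal S R"
    if "subring (IntVal S R) QDx" "f \<in> IntVal S R" "g \<in> IntVal S R" for f g
    using that by (rule subringE(6))
  ultimately show ?thesis
    unfolding ringset_def by blast
qed

text \<open>
  A central affine map commutes with conjugation. Hence if two polynomials are pulled back along
  it as functions, then so is their product, by the conjugation formula for values of products.
\<close>

lemma ringset_affine_image:
  assumes R: "unital_subgroup R"
    and c: "\<And>q. c * q = q * c" and d: "\<And>q. d * q = q * d"
    and T: "ringset R T" and S: "(\<lambda>t. c * t + d) ` T \<subseteq> R"
  shows "ringset R ((\<lambda>t. c * t + d) ` T)"
proof -
  let ?S = "(\<lambda>t. c * t + d) ` T"
  have "F \<otimes>\<^bsub>QDx\<^esub> G \<in> IntVal ?S R" if F: "F \<in> IntVal ?S R" and G: "G \<in> IntVal ?S R" for F G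
  proof -
    have FG: "F \<in> carrier QDx" "G \<in> carrier QDx" using F G by (auto simp: IntVal_def)
    obtain f where f: "f \<in> carrier QDx" "\<And>q. qeval f q = qeval F (c * q + d)"
      using affine_substitution[OF FG(1) c d] by blast
    obtain g where g: "g \<in> carrier QDx" "\<And>q. qeval g q = qeval G (c * q + d)"
      using affine_substitution[OF FG(2) c d] by blast
    have "f \<in> IntVal T R" "g \<in> IntVal T R"
      using F G f g by (auto simp: IntVal_def)
    then have fg: "f \<otimes>\<^bsub>QDx\<^esub> g \<in> IntVal T R"
      using T R by (simp add: ringset_iff_mult_closed)
    have "qeval (F \<otimes>\<^bsub>QDx\<^esub> G) (c * t + d) = qeval (f \<otimes>\<^bsub>QDx\<^esub> g) t" for t
    proof -
      have conj: "b * (c * t + d) * inverse b = c * (b * t * inverse b) + d" if "b \<noteq> 0" for b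
      proof -
        have "b * (c * t + d) = c * (b * t) + d * b"
          by (metis c d distrib_left mult.assoc)
        then show ?thesis
          using that by (simp add: distrib_right mult.assoc)
      qed
      show ?thesis
        by (simp add: qeval_mult[OF FG] qeval_mult[OF f(1) g(1)] f(2) g(2) conj)
    qed
    then show ?thesis
      using fg FG by (auto simp: IntVal_def)
  qed
  then show ?thesis
    using R S by (simp add: ringset_iff_mult_closed)
qed

lemma of_int_quat_central: "of_int n * q = q * (of_int n :: quat)"
  by (simp add: quat_of_int quat_eq_iff mult.commute)

lemma translate_dilate: "translate a (dilate n T) = (\<lambda>t. of_int n * t + of_int a) ` T"
  by (auto simp: translate_def dilate_def image_def add.commute)

lemma ringset_translate_dilate_iff:
  assumes R: "unital_subgroup R" and n: "n \<ge> 1"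
    and T: "T \<subseteq> R" and S: "translate a (dilate n T) \<subseteq> R"
  shows "ringset R (translate a (dilate n T)) \<longleftrightarrow> ringset R T"
proof
  assume "ringset R T"
  then show "ringset R (translate a (dilate n T))"
    unfolding translate_dilate using R S
    by (intro ringset_affine_image) (auto simp: of_int_quat_central translate_dilate)
next
  define c d :: quat where "c = inverse (of_int n)" and "d = - (c * of_int a)"
  have n0: "(of_int n :: quat) \<noteq> 0"
    using n by (simp add: quat_of_int quat_eq_iff)
  have c: "c * q = q * c" for q
    unfolding c_def
    by (simp add: quat_eq_iff quat_of_int qnorm_def mult.commute)
  have d: "d * q = q * d" for q
    unfolding d_def by (metis c mult.assoc mult_minus_left mult_minus_right of_int_quat_central)
  have "c * (of_int n * t + of_int a) + d = t" for t
    using n0 by (simp add: distrib_left c_def d_def mult.assoc[symmetric])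
  then have inv: "(\<lambda>s. c * s + d) ` translate a (dilate n T) = T"
    unfolding translate_dilate image_image by simp
  assume "ringset R (translate a (dilate n T))"
  from ringset_affine_image[OF R c d this] T show "ringset R T"
    by (simp add: inv)
qed


section \<open>Integrality in the two orders\<close>

lemma half_ints_iff: "x \<in> half_ints \<longleftrightarrow> x - 1 / 2 \<in> \<int>"
proof
  assume "x - 1 / 2 \<in> \<int>"
  then obtain k where "x - 1 / 2 = of_int k" by (rule Ints_cases)
  then show "x \<in> half_ints" unfolding half_ints_def by (auto simp: algebra_simps)
qed (auto simp: half_ints_def)

lemma half_ints_add: "x + y \<in> \<int>" if "x \<in> half_ints" "y \<in> half_ints"
proof -
  have "(x - 1 / 2) + (y - 1 / 2) + 1 \<in> \<int>"
    using that unfolding half_ints_iff by (intro Ints_add Ints_1)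
  then show ?thesis by simp
qed

lemma half_ints_minus: "- x \<in> half_ints" if "x \<in> half_ints"
proof -
  have "- (x - 1 / 2) - 1 \<in> \<int>"
    using that unfolding half_ints_iff by (rule Ints_diff[OF Ints_minus Ints_1])
  moreover have "- (x - 1 / 2) - 1 = - x - 1 / 2" by simp
  ultimately show ?thesis unfolding half_ints_iff by (simp only:)
qed

lemma half_ints_add_Ints: "x + y \<in> half_ints" "y + x \<in> half_ints"
  if "x \<in> half_ints" "y \<in> \<int>"
proof -
  have "(x - 1 / 2) + y \<in> \<int>"
    using that unfolding half_ints_iff by (intro Ints_add)
  then show "x + y \<in> half_ints" "y + x \<in> half_ints"
    by (simp_all add: half_ints_iff algebra_simps)
qed

lemma unital_subgroup_orders:
  assumes "R \<in> {Lipschitz, Hurwitz}"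
  shows "unital_subgroup R"
proof -
  have "unital_subgroup Lipschitz"
    by (auto simp: unital_subgroup_def Lipschitz_def)
  moreover have "unital_subgroup Hurwitz"
    by (auto simp: unital_subgroup_def Hurwitz_def half_ints_add half_ints_minus half_ints_add_Ints)
  ultimately show ?thesis using assms by auto
qed

lemma Lipschitz_subset_Hurwitz: "Lipschitz \<subseteq> Hurwitz"
  by (auto simp: Lipschitz_def Hurwitz_def)

lemma Hurwitz_double_Ints:
  assumes "\<alpha> \<in> Hurwitz"
  shows "2 * q_re \<alpha> \<in> \<int>" "2 * q_i \<alpha> \<in> \<int>" "2 * q_j \<alpha> \<in> \<int>" "2 * q_k \<alpha> \<in> \<int>"
proof -
  have "2 * x \<in> \<int>" if "x \<in> \<int> \<or> x \<in> half_ints" for x :: rat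
    using that half_ints_add[of x x] by auto
  then show "2 * q_re \<alpha> \<in> \<int>" "2 * q_i \<alpha> \<in> \<int>" "2 * q_j \<alpha> \<in> \<int>" "2 * q_k \<alpha> \<in> \<int>"
    using assms unfolding Hurwitz_def by blast+
qed

lemma Hurwitz_qnorm_Ints:
  assumes "\<alpha> \<in> Hurwitz"
  shows "qnorm \<alpha> \<in> \<int>"
proof -
  have sq: "x\<^sup>2 - 1 / 4 \<in> \<int>" if "x \<in> half_ints" for x
  proof -
    have "(x - 1 / 2) * (x - 1 / 2) + (x - 1 / 2) \<in> \<int>"
      using that unfolding half_ints_iff by (intro Ints_add Ints_mult)
    then show ?thesis by (simp add: algebra_simps power2_eq_square)
  qed
  show ?thesis
  proof (cases "q_re \<alpha> \<in> \<int> \<and> q_i \<alpha> \<in> \<int> \<and> q_j \<alpha> \<in> \<int> \<and> q_k \<alpha> \<in> \<int>")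
    case True
    then show ?thesis unfolding qnorm_def by (intro Ints_add Ints_power) auto
  next
    case False
    with assms have "(q_re \<alpha>)\<^sup>2 - 1 / 4 + ((q_i \<alpha>)\<^sup>2 - 1 / 4) + ((q_j \<alpha>)\<^sup>2 - 1 / 4)
        + ((q_k \<alpha>)\<^sup>2 - 1 / 4) + 1 \<in> \<int>"
      unfolding Hurwitz_def by (intro Ints_add sq) auto
    then show ?thesis by (simp add: qnorm_def add.assoc)
  qed
qed


section \<open>Minimal polynomial classes\<close>

abbreviation scalar :: "quat \<Rightarrow> bool"
  where "scalar \<alpha> \<equiv> q_i \<alpha> = 0 \<and> q_j \<alpha> = 0 \<and> q_k \<alpha> = 0"

lemma min_poly_eq_monic_quadraticD:
  assumes m: "monic_quadratic m" and eq: "min_poly \<alpha> = map_poly of_int m"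
  shows "\<not> scalar \<alpha>" "qnorm \<alpha> = of_int (Polynomial.coeff m 0)"
    "- 2 * q_re \<alpha> = of_int (Polynomial.coeff m 1)"
proof -
  have "Polynomial.degree (map_poly of_int m :: rat poly) = 2"
    using m by (simp add: monic_quadratic_def degree_map_poly)
  then have "Polynomial.degree (min_poly \<alpha>) = 2"
    by (simp only: eq)
  then show ns: "\<not> scalar \<alpha>"
    by (auto simp: min_poly_def)
  have "Polynomial.coeff (min_poly \<alpha>) k = of_int (Polynomial.coeff m k)" for k
    by (simp add: eq coeff_map_poly)
  from this[of 0] this[of 1] ns show "qnorm \<alpha> = of_int (Polynomial.coeff m 0)"
    "- 2 * q_re \<alpha> = of_int (Polynomial.coeff m 1)"
    by (auto simp: min_poly_def)
qed

text \<open>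
  The common monic quadratic exists because trace and norm of a Hurwitz quaternion are integers.
\<close>

lemma subset_min_poly_classI:
  assumes R: "R \<subseteq> Hurwitz" and T: "T \<subseteq> R" "T \<noteq> {}"
    and ns: "\<And>t. t \<in> T \<Longrightarrow> \<not> scalar t"
    and re: "\<And>s t. s \<in> T \<Longrightarrow> t \<in> T \<Longrightarrow> q_re s = q_re t"
    and nm: "\<And>s t. s \<in> T \<Longrightarrow> t \<in> T \<Longrightarrow> qnorm s = qnorm t"
  shows "\<exists>m. monic_quadratic m \<and> T \<subseteq> min_poly_class R m"
proof -
  from T obtain t where t: "t \<in> T" "t \<in> Hurwitz" using R by blast
  obtain b where b: "2 * q_re t = of_int b"
    using Hurwitz_double_Ints(1)[OF t(2)] by (rule Ints_cases)
  obtain c where c: "qnorm t = of_int c"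
    using Hurwitz_qnorm_Ints[OF t(2)] by (rule Ints_cases)
  have "min_poly s = map_poly of_int [:c, - b, 1:]" if s: "s \<in> T" for s
    using ns[OF s] re[OF s t(1)] nm[OF s t(1)] b c
    by (simp add: min_poly_def map_poly_pCons)
  then have "T \<subseteq> min_poly_class R [:c, - b, 1:]"
    using T by (auto simp: min_poly_class_def)
  moreover have "monic_quadratic [:c, - b, 1:]"
    by (simp add: monic_quadratic_def)
  ultimately show ?thesis by blast
qed


section \<open>Existence of the reduced set\<close>

lemma Ints_scale_bound:
  fixes x :: rat
  assumes "2 * x \<in> \<int>" "x \<noteq> 0" "n \<ge> 1"
  shows "of_int n \<le> 2 * \<bar>of_int n * x\<bar>"
proof -
  have "\<bar>2 * x\<bar> \<ge> 1" using assms by (intro Ints_nonzero_abs_ge1) auto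
  then have "of_int n * 1 \<le> of_int n * \<bar>2 * x\<bar>"
    using assms by (intro mult_left_mono) auto
  then show ?thesis using assms by (simp add: abs_mult)
qed

text \<open>
  A nonzero imaginary component of \<open>a + n \<beta>\<close> is \<open>n\<close> times half of a nonzero integer, so
  its absolute value is at least \<open>n / 2\<close>. This bound is what makes a largest dilation factor
  exist: the elements of a minimal polynomial class of degree two are not scalar.
\<close>

lemma dilation_factor_bounded:
  assumes R: "R \<subseteq> Hurwitz" and s: "s \<in> translate a (dilate n R)" "\<not> scalar s" and n: "n \<ge> 1"
  shows "of_int n \<le> 2 * (\<bar>q_i s\<bar> + \<bar>q_j s\<bar> + \<bar>q_k s\<bar>)"
proof -
  from s obtain t where t: "t \<in> Hurwitz" "s = of_int n * t + of_int a"
    unfolding translate_dilate using R by blast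
  have eqs: "q_i s = of_int n * q_i t" "q_j s = of_int n * q_j t" "q_k s = of_int n * q_k t"
    by (simp_all add: t quat_of_int)
  have b: "of_int n \<le> 2 * \<bar>of_int n * x\<bar>" if "2 * x \<in> \<int>" "x \<noteq> 0" for x :: rat
    using that n by (rule Ints_scale_bound)
  from s(2) consider "q_i t \<noteq> 0" | "q_j t \<noteq> 0" | "q_k t \<noteq> 0"
    unfolding eqs by auto
  then have "of_int n \<le> 2 * \<bar>q_i s\<bar> \<or> of_int n \<le> 2 * \<bar>q_j s\<bar> \<or> of_int n \<le> 2 * \<bar>q_k s\<bar>"
    unfolding eqs using b Hurwitz_double_Ints[OF t(1)] by cases blast+
  then show ?thesis
    using abs_ge_zero[of "q_i s"] abs_ge_zero[of "q_j s"] abs_ge_zero[of "q_k s"]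
    by (elim disjE) (simp_all add: distrib_left add_increasing add_increasing2)
qed

text \<open>
  Condition (ii) of being reduced is maximality of the dilation factor: if a translate of the
  preimage \<open>T\<close> were contained in \<open>k R\<close>, then \<open>n k\<close> would be a larger factor for \<open>S\<close>.
  The other condition transfers because trace and norm of \<open>t\<close> are determined by those of
  \<open>n t + a\<close>.
\<close>

lemma ex_reduced_affine_preimage:
  assumes R: "R \<subseteq> Hurwitz" "0 \<in> R" and S: "S \<subseteq> R" "S \<noteq> {}"
    and m: "monic_quadratic m" "S \<subseteq> min_poly_class R m"
  obtains T a n where "T \<subset> R" "reduced R T" "n \<ge> 1" "S = translate a (dilate n T)"
proof -
  define P where "P = (\<lambda>n :: nat. n \<ge> 1 \<and> (\<exists>a. S \<subseteq> translate a (dilate (int n) R)))"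
  have Sm: "\<not> scalar s" "qnorm s = of_int (Polynomial.coeff m 0)"
    "- 2 * q_re s = of_int (Polynomial.coeff m 1)" if "s \<in> S" for s
    using min_poly_eq_monic_quadraticD[OF m(1), of s] that m(2)
    by (auto simp: min_poly_class_def)
  from S obtain s where s: "s \<in> S" by blast
  define B where "B = nat \<lceil>2 * (\<bar>q_i s\<bar> + \<bar>q_j s\<bar> + \<bar>q_k s\<bar>)\<rceil>"
  have P1: "P 1"
    using S unfolding P_def translate_dilate by (intro conjI exI[of _ 0]) auto
  have PB: "n \<le> B" if "P n" for n
  proof -
    have "of_int (int n) \<le> 2 * (\<bar>q_i s\<bar> + \<bar>q_j s\<bar> + \<bar>q_k s\<bar>)"
      using that s Sm(1)[OF s] unfolding P_def
      by (elim conjE exE, intro dilation_factor_bounded[OF R(1)]) auto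
    then show ?thesis unfolding B_def by (simp add: le_nat_iff) linarith
  qed
  define n where "n = int (Greatest P)"
  have "P (Greatest P)" using P1 PB by (rule GreatestI_nat)
  then obtain a where n: "n \<ge> 1" and Sa: "S \<subseteq> translate a (dilate n R)"
    unfolding P_def n_def by auto
  define T where "T = {t \<in> R. of_int n * t + of_int a \<in> S}"
  have ST: "S = translate a (dilate n T)"
    using Sa unfolding T_def translate_dilate by auto
  have TR: "T \<subseteq> R" by (auto simp: T_def)
  have T_ne: "T \<noteq> {}" using ST S by (auto simp: translate_dilate)
  have im: "q_re (of_int n * t + of_int a) = of_int n * q_re t + of_int a"
    "q_i (of_int n * t + of_int a) = of_int n * q_i t"
    "q_j (of_int n * t + of_int a) = of_int n * q_j t"
    "q_k (of_int n * t + of_int a) = of_int n * q_k t" for t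
    by (simp_all add: quat_of_int)
  have T_S: "of_int n * t + of_int a \<in> S" if "t \<in> T" for t using that by (simp add: T_def)
  have ns: "\<not> scalar t" if "t \<in> T" for t
    using Sm(1)[OF T_S[OF that]] unfolding im by auto
  have re: "q_re t = q_re u" if "t \<in> T" "u \<in> T" for t u
  proof -
    have "- 2 * (of_int n * q_re t + of_int a) = - 2 * (of_int n * q_re u + of_int a)"
      using Sm(3)[OF T_S[OF that(1)]] Sm(3)[OF T_S[OF that(2)]] unfolding im by (metis)
    then show ?thesis using n by simp
  qed
  have nm: "qnorm t = qnorm u" if "t \<in> T" "u \<in> T" for t u
  proof -
    define f where "f = (\<lambda>t. (q_i t)\<^sup>2 + (q_j t)\<^sup>2 + (q_k t)\<^sup>2)"
    have q: "qnorm t = (q_re t)\<^sup>2 + f t" for t by (simp add: qnorm_def f_def)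
    have f: "f (of_int n * t + of_int a) = (of_int n)\<^sup>2 * f t" for t
      unfolding f_def im by (simp add: power_mult_distrib distrib_left)
    have "(of_int n)\<^sup>2 * f t = (of_int n)\<^sup>2 * f u"
      using Sm(2)[OF T_S[OF that(1)]] Sm(2)[OF T_S[OF that(2)]] re[OF that]
      unfolding q f im by (metis add_left_cancel)
    then show ?thesis using n re[OF that] by (simp add: q)
  qed
  have quad: "\<exists>m'. monic_quadratic m' \<and> T \<subseteq> min_poly_class R m'"
    by (rule subset_min_poly_classI[OF R(1) TR T_ne]) (fact ns re nm)+
  have "\<not> translate b T \<subseteq> dilate k R" if k: "k \<ge> 2" for b k
  proof
    assume sub: "translate b T \<subseteq> dilate k R"
    \<comment> \<open>From \<open>t + b = k r\<close> it follows that \<open>n t + a = n k r + (a - n b)\<close>, so \<open>n k\<close>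
      is a larger common dilation factor of \<open>S\<close>.\<close>
    have "S \<subseteq> translate (a - n * b) (dilate (n * k) R)"
    proof
      fix x assume "x \<in> S"
      then obtain t where t: "t \<in> T" "x = of_int n * t + of_int a"
        using ST unfolding translate_dilate by auto
      then obtain r where r: "r \<in> R" "of_int b + t = of_int k * r"
        using sub unfolding translate_def dilate_def by blast
      have t_eq: "t = of_int k * r - of_int b" using r(2) by (simp add: algebra_simps)
      have "x = of_int (n * k) * r + of_int (a - n * b)"
        unfolding t(2) t_eq by (simp add: right_diff_distrib mult.assoc add_diff_eq diff_add_eq)
      then show "x \<in> translate (a - n * b) (dilate (n * k) R)"
        using r(1) unfolding translate_dilate by blast
    qed
    moreover have nk: "n * k > n" using n k by simp
    moreover have "int (nat (n * k)) = n * k" "nat (n * k) \<ge> 1" using nk n by linarith+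
    ultimately have "P (nat (n * k))" unfolding P_def by metis
    then have "nat (n * k) \<le> Greatest P" using PB by (rule Greatest_le_nat)
    then show False using nk n_def by linarith
  qed
  then have "reduced R T" using TR quad by (simp add: reduced_def)
  moreover have "T \<subset> R" using TR R(2) ns[of 0] by auto
  ultimately show ?thesis using that n ST by blast
qed


theorem proposition2p11:
  fixes R S :: "quat set" and m :: "int poly"
  assumes "R \<in> {Lipschitz, Hurwitz}"
    and "S \<subset> R" and "S \<noteq> {}"
    and "monic_quadratic m" and "S \<subseteq> min_poly_class R m"
  shows "(\<exists>T. T \<subset> R \<and> reduced R T \<and>
            (\<exists>a n :: int. n \<ge> 1 \<and> S = translate a (dilate n T))) \<and>
         (\<forall>T. T \<subset> R \<and> reduced R T \<and>
            (\<exists>a n :: int. n \<ge> 1 \<and> S = translate a (dilate n T)) \<longrightarrow>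
            (ringset R S \<longleftrightarrow> ringset R T))"
proof (intro conjI allI impI)
  have "R \<subseteq> Hurwitz" "0 \<in> R"
    using assms(1) Lipschitz_subset_Hurwitz by (auto simp: Lipschitz_def Hurwitz_def)
  moreover have "S \<subseteq> R" using assms(2) by blast
  ultimately obtain T a n where "T \<subset> R" "reduced R T" "n \<ge> 1" "S = translate a (dilate n T)"
    using assms(3-5) by (rule ex_reduced_affine_preimage)
  then show "\<exists>T. T \<subset> R \<and> reduced R T \<and>
      (\<exists>a n :: int. n \<ge> 1 \<and> S = translate a (dilate n T))"
    by blast
next
  fix T
  assume "T \<subset> R \<and> reduced R T \<and> (\<exists>a n :: int. n \<ge> 1 \<and> S = translate a (dilate n T))"
  then obtain a n where T: "T \<subset> R" "n \<ge> 1" "S = translate a (dilate n T)" by blast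
  show "ringset R S \<longleftrightarrow> ringset R T"
    unfolding T(3)
    using unital_subgroup_orders[OF assms(1)] T assms(2)
    by (intro ringset_translate_dilate_iff) auto
qed

end
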